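(* Let $K$ be a field of characteristic zero with commuting derivations $\partial,\partial_1,\ldots,\partial_d$ from $K$ to itself, and let $k:=K^{\partial}=\{a\in K: \partial a=0\}$. Suppose that for all $i$, $1\leqslant i\leqslant d-1$, all consistent systems of linear differential equations over $k$ that involve only the derivations $\partial_1,\ldots,\partial_i$ have a fundamental solution matrix with entries in $k$. Let $A$ be an $(n\times n)$-matrix with entries in $K$ and suppose that there exist $(n\times n)$-matrices $B_1,\ldots,B_d$ with entries in $K$ that satisfy $$\partial_iA-\partial B_i=[B_i,A]$$ for all $i$, $1\leqslant i\leqslant d$. Then there exist $(n\times n)$-matrices $A_1,\ldots,A_d$ with entries in $K$ such that $$\partial_iA-\partial A_i=[A_i,A]$$ for all $i$, $1\leqslant i\leqslant d$, and $$\partial_iA_j-\partial_jA_i=[A_i,A_j]$$ for all $i,j$, $1\leqslant i,j\leqslant d$.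
   Context: Derivations are applied to matrices entrywise, and $[X,Y]=XY-YX$. Since the derivations commute, each $\partial_i$ preserves $k$. A system of linear differential equations over $k$ involving only $\partial_1,\ldots,\partial_i$ is a system $\partial_jY=C_jY$, $1\leqslant j\leqslant i$, with $C_j$ being $(m\times m)$-matrices over $k$; it is consistent if $\partial_aC_b-\partial_bC_a=[C_a,C_b]$ for all $1\leqslant a,b\leqslant i$; a fundamental solution matrix is an invertible $(m\times m)$-matrix $Y$ satisfying all the equations. *)

theory Defs
  imports "Jordan_Normal_Form.Matrix"
begin

definition derivation :: "('a::comm_ring_1 \<Rightarrow> 'a) \<Rightarrow> bool" where
  "derivation D \<longleftrightarrow> (\<forall>a b. D (a + b) = D a + D b) \<and> (\<forall>a b. D (a * b) = D a * b + a * D b)"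

definition commuting_maps :: "('a \<Rightarrow> 'a) \<Rightarrow> ('a \<Rightarrow> 'a) \<Rightarrow> bool" where
  "commuting_maps D E \<longleftrightarrow> (\<forall>a. D (E a) = E (D a))"

definition constants :: "('a::zero \<Rightarrow> 'a) \<Rightarrow> 'a set" where
  "constants D = {a. D a = 0}"

definition mat_commutator :: "'a::ring_1 mat \<Rightarrow> 'a mat \<Rightarrow> 'a mat" where
  "mat_commutator X Y = X * Y - Y * X"

definition mat_over :: "'a set \<Rightarrow> nat \<Rightarrow> 'a mat \<Rightarrow> bool" where
  "mat_over k m X \<longleftrightarrow> X \<in> carrier_mat m m \<and> elements_mat X \<subseteq> k"

text \<open>The system \<open>\<partial>\<^sub>j Y = C\<^sub>j Y\<close>, \<open>1 \<le> j \<le> i\<close>, is represented by its family of coefficient matrices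
  \<open>C\<close>; the values of \<open>C\<close> outside \<open>{1..i}\<close> play no role. A derivation \<open>D\<close> acts on matrices entrywise
  as \<open>map_mat D\<close>.\<close>

definition linear_system :: "'a set \<Rightarrow> nat \<Rightarrow> nat \<Rightarrow> (nat \<Rightarrow> 'a mat) \<Rightarrow> bool" where
  "linear_system k i m C \<longleftrightarrow> (\<forall>j\<in>{1..i}. mat_over k m (C j))"

definition consistent_system ::
    "(nat \<Rightarrow> 'a::ring_1 \<Rightarrow> 'a) \<Rightarrow> nat \<Rightarrow> (nat \<Rightarrow> 'a mat) \<Rightarrow> bool" where
  "consistent_system D i C \<longleftrightarrow>
     (\<forall>a\<in>{1..i}. \<forall>b\<in>{1..i}.
        map_mat (D a) (C b) - map_mat (D b) (C a) = mat_commutator (C a) (C b))"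

text \<open>Invertibility refers to the ambient ring; when that ring is a field and the entries of \<open>Y\<close> lie in a
  subfield, the entries of the inverse of \<open>Y\<close> lie in that subfield as well.\<close>

definition fundamental_solution_matrix ::
    "(nat \<Rightarrow> 'a::ring_1 \<Rightarrow> 'a) \<Rightarrow> nat \<Rightarrow> nat \<Rightarrow> (nat \<Rightarrow> 'a mat) \<Rightarrow> 'a mat \<Rightarrow> bool" where
  "fundamental_solution_matrix D i m C Y \<longleftrightarrow>
     Y \<in> carrier_mat m m \<and> invertible_mat Y \<and> (\<forall>j\<in>{1..i}. map_mat (D j) Y = C j * Y)"

end

theory Submission
  imports Defs "HOL-Library.Function_Algebras"
begin

text \<open>
  The operators \<open>\<nabla>\<^sub>j = \<partial>\<^sub>j - [A\<^sub>j, _]\<close> and \<open>\<nabla> = \<partial> - [A, _]\<close> act on matrices, and the required identities say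
  that these connections are pairwise flat. One constructs \<open>A\<^sub>1, A\<^sub>2, \<dots>\<close> inductively as \<open>A\<^sub>i\<^sub>+\<^sub>1 = B\<^sub>i\<^sub>+\<^sub>1 + X\<close>,
  where \<open>X\<close> has to lie in \<open>E = ker \<nabla>\<close> and solve \<open>\<nabla>\<^sub>j X = F\<^sub>j\<close> for \<open>j \<le> i\<close>, with \<open>F\<^sub>j\<close> the curvature of \<open>A\<^sub>j\<close>
  against \<open>B\<^sub>i\<^sub>+\<^sub>1\<close>. The Bianchi identity yields \<open>F\<^sub>j \<in> E\<close> and \<open>\<nabla>\<^sub>a F\<^sub>b = \<nabla>\<^sub>b F\<^sub>a\<close>. A maximal \<open>K\<close>-linearly independent
  family in \<open>E\<close> is a \<open>k\<close>-basis of \<open>E\<close>, because applying \<open>\<nabla>\<close> to a \<open>K\<close>-combination that lies in \<open>E\<close> shows that its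
  coefficients are constants. In these coordinates the equations for \<open>X\<close> become a consistent inhomogeneous
  linear system over \<open>k\<close>, which is solved by making it homogeneous with one more unknown.
\<close>

section \<open>Derivations on scalars and, entrywise, on matrices\<close>

lemma derivation_simps:
  assumes "derivation D"
  shows "D (a + b) = D a + D b" "D (a * b) = D a * b + a * D b" "D 0 = 0" "D (- a) = - D a"
    "D (a - b) = D a - D b"
proof -
  show add: "D (a + b) = D a + D b" and "D (a * b) = D a * b + a * D b" for a b
    using assms unfolding derivation_def by auto
  show zero: "D 0 = 0"
    using add[of 0 0] by simp
  show neg: "D (- a) = - D a" for a
    using add[of a "- a"] zero by (simp add: eq_neg_iff_add_eq_0 add.commute)
  show "D (a - b) = D a - D b"
    using add[of a "- b"] neg[of b] by simp
qed

lemma derivation_sum: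
  assumes "derivation D"
  shows "D (\<Sum>x\<in>S. f x) = (\<Sum>x\<in>S. D (f x))"
  by (induction S rule: infinite_finite_induct) (simp_all add: derivation_simps[OF assms])

text \<open>Serves to normalise a solution vector by one of its entries. For \<open>c = 0\<close>
  both sides are 0, since \<open>a / 0 = 0\<close>.\<close>

lemma derivation_divide_constant:
  fixes D :: "'a::field \<Rightarrow> 'a"
  assumes "derivation D" "D c = 0"
  shows "D (a / c) = D a / c"
proof (cases "c = 0")
  case False
  have "D a = D (a / c * c)"
    using False by simp
  also have "\<dots> = D (a / c) * c"
    unfolding derivation_simps(2)[OF assms(1)] using assms by simp
  finally show ?thesis
    using False by simp
qed (simp add: derivation_simps[OF assms(1)])

lemma map_mat_derivation:
  assumes "derivation D" "X \<in> carrier_mat n n" "Y \<in> carrier_mat n n"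
  shows "map_mat D (X + Y) = map_mat D X + map_mat D Y"
    "map_mat D (X - Y) = map_mat D X - map_mat D Y"
    "map_mat D (X * Y) = map_mat D X * Y + X * map_mat D Y"
  using assms
  by (auto intro!: eq_matI
      simp: derivation_simps[OF assms(1)] derivation_sum[OF assms(1)] scalar_prod_def sum.distrib)

lemma map_mat_commute:
  assumes "commuting_maps D E"
  shows "map_mat D (map_mat E X) = map_mat E (map_mat D X)"
  using assms by (auto simp: commuting_maps_def)

section \<open>Connections on matrices and their curvature\<close>

definition cov :: "('a::ring_1 \<Rightarrow> 'a) \<Rightarrow> 'a mat \<Rightarrow> 'a mat \<Rightarrow> 'a mat" where
  "cov D A X = map_mat D X - mat_commutator A X"

text \<open>For commuting derivations, the commutator of the operators \<open>cov D A\<close> and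
  \<open>cov E B\<close> is \<open>mat_commutator (curv D A E B)\<close>; this fixes the
  sign.\<close>

definition curv :: "('a::ring_1 \<Rightarrow> 'a) \<Rightarrow> 'a mat \<Rightarrow> ('a \<Rightarrow> 'a) \<Rightarrow> 'a mat \<Rightarrow> 'a mat" where
  "curv D A E B = map_mat E A - map_mat D B + mat_commutator A B"

lemma mat_commutator_carrier [simp]:
  "A \<in> carrier_mat n n \<Longrightarrow> X \<in> carrier_mat n n \<Longrightarrow> mat_commutator A X \<in> carrier_mat n n"
  by (auto simp: mat_commutator_def intro: minus_carrier_mat)

lemma cov_carrier [simp]:
  "A \<in> carrier_mat n n \<Longrightarrow> X \<in> carrier_mat n n \<Longrightarrow> cov D A X \<in> carrier_mat n n"
  by (auto simp: cov_def intro: minus_carrier_mat)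

lemma curv_carrier [simp]:
  "A \<in> carrier_mat n n \<Longrightarrow> B \<in> carrier_mat n n \<Longrightarrow> curv D A E B \<in> carrier_mat n n"
  by (auto simp: curv_def)

lemma curv_eq_0_iff:
  assumes "A \<in> carrier_mat n n" "B \<in> carrier_mat n n"
  shows "curv D A E B = 0\<^sub>m n n \<longleftrightarrow> map_mat D B - map_mat E A = mat_commutator A B"
  using assms
  by (auto simp: curv_def mat_eq_iff algebra_simps eq_diff_eq mat_commutator_def simp del: index_mult_mat(1))

lemma curv_self:
  assumes "A \<in> carrier_mat n n"
  shows "curv D A D A = 0\<^sub>m n n"
  using assms by (auto simp: curv_def mat_commutator_def intro!: eq_matI)

lemma curv_swap_eq_0:
  assumes "A \<in> carrier_mat n n" "B \<in> carrier_mat n n"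
  shows "curv D A E B = 0\<^sub>m n n \<longleftrightarrow> curv E B D A = 0\<^sub>m n n"
  using assms
  by (auto simp: curv_def mat_eq_iff algebra_simps mat_commutator_def simp del: index_mult_mat(1))

text \<open>Flatness serves as a rewrite rule eliminating \<open>map_mat D B\<close>; after
  expansion, both sides agree because the derivations commute. The second claim is the cyclic
  Bianchi identity for three connections, with the term \<open>cov G X (curv D A E B)\<close> gone
  and \<open>curv\<close> antisymmetric. There \<open>X\<close> is the connection matrix belonging
  to \<open>G\<close>.\<close>

lemma
  fixes D E G :: "'a::comm_ring_1 \<Rightarrow> 'a"
  assumes D: "derivation D" and E: "derivation E" and DE: "commuting_maps D E"
    and c: "A \<in> carrier_mat n n" "B \<in> carrier_mat n n" "X \<in> carrier_mat n n"
    and flat: "curv D A E B = 0\<^sub>m n n"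
  shows cov_commute: "cov D A (cov E B X) = cov E B (cov D A X)"
    and bianchi: "derivation G \<Longrightarrow> commuting_maps D G \<Longrightarrow> commuting_maps E G \<Longrightarrow>
       cov D A (curv E B G X) = cov E B (curv D A G X)"
proof -
  note dist = map_mat_derivation[where n = n] minus_mult_distrib_mat[of _ n n _ _ n] mult_minus_distrib_mat[of _ n n _ n]
   add_mult_distrib_mat[of _ n n _ _ n] mult_add_distrib_mat[of _ n n _ n] assoc_mult_mat[of _ n n _ n _ n]
    minus_carrier_mat mult_carrier_mat[of _ n n _ n] add_carrier_mat
  have *: "map_mat D B = map_mat E A + (A * B - B * A)"
    using c flat unfolding curv_eq_0_iff[OF c(1,2)] mat_commutator_def
    by (auto simp: mat_eq_iff algebra_simps simp del: index_mult_mat(1))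
  show "cov D A (cov E B X) = cov E B (cov D A X)"
    using c
    by (simp add: cov_def mat_commutator_def dist D E * map_mat_commute[OF DE])
      (rule eq_matI, simp_all del: index_mult_mat(1))
  assume G: "derivation G" and DG: "commuting_maps D G" and EG: "commuting_maps E G"
  show "cov D A (curv E B G X) = cov E B (curv D A G X)"
    using c
    by (simp add: cov_def curv_def mat_commutator_def dist D E G *
        map_mat_commute[OF DE] map_mat_commute[OF DG] map_mat_commute[OF EG])
      (rule eq_matI, simp_all del: index_mult_mat(1))
qed

text \<open>Only one of the two connections moves, so the change is linear in \<open>X\<close>. This
  turns the search for a flat correction of \<open>B\<close> into a linear equation.\<close>

lemma curv_add_right:
  assumes "derivation D" "A \<in> carrier_mat n n" "B \<in> carrier_mat n n" "X \<in> carrier_mat n n"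
  shows "curv D A E (B + X) = curv D A E B - cov D A X"
proof -
  note dist = add_mult_distrib_mat[of _ n n _ _ n] mult_add_distrib_mat[of _ n n _ n]
  show ?thesis
    using assms
    by (auto simp: curv_def cov_def mat_commutator_def dist derivation_simps[OF assms(1)] intro!: eq_matI
        simp del: index_mult_mat(1))
qed

section \<open>Linear combinations of matrices and coordinates\<close>

definition lincomb_mat :: "nat \<Rightarrow> nat \<Rightarrow> (nat \<Rightarrow> 'a::comm_ring_1 mat) \<Rightarrow> (nat \<Rightarrow> 'a) \<Rightarrow> 'a mat" where
  "lincomb_mat n r e c = mat n n (\<lambda>ij. \<Sum>s<r. c s * e s $$ ij)"

text \<open>Matrices are transported to functions on index pairs, which form a vector space under
  pointwise operations. A maximal independent subset of the image exists there, and it is finite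
  because the images lie in the span of the finitely many matrix units.\<close>

lemma maximal_independent_family:
  fixes S :: "'a::field mat set"
  assumes S: "S \<subseteq> carrier_mat n n"
  obtains r e where "\<And>s. s < r \<Longrightarrow> e s \<in> S"
    and "\<And>X. X \<in> S \<Longrightarrow> \<exists>c. X = lincomb_mat n r e c"
    and "\<And>c s. lincomb_mat n r e c = 0\<^sub>m n n \<Longrightarrow> s < r \<Longrightarrow> c s = 0"
proof -
  define scale where "scale c f = (\<lambda>x. c * f x)" for c :: 'a and f :: "nat \<times> nat \<Rightarrow> 'a"
  interpret V: vector_space scale
    by unfold_locales (auto simp: scale_def algebra_simps fun_eq_iff)
  \<comment> \<open>Extension by zero makes the values outside the index range definite;
    \<open>T\<close> consists of the matrix units.\<close>
  define \<phi> where "\<phi> X = (\<lambda>(i, j). if i < n \<and> j < n then X $$ (i, j) else 0)" for X :: "'a mat"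
  define T where "T = (\<lambda>p x. if x = p then 1 else 0 :: 'a) ` ({..<n} \<times> {..<n})"
  have sum_apply: "(\<Sum>v\<in>W. g v) x = (\<Sum>v\<in>W. g v x)"
    for g :: "'c \<Rightarrow> nat \<times> nat \<Rightarrow> 'a" and W x
    by (induction W rule: infinite_finite_induct) auto
  obtain B where B: "B \<subseteq> \<phi> ` S" "V.independent B" "\<phi> ` S \<subseteq> V.span B"
    using V.maximal_independent_subset by blast
  have "\<phi> X \<in> V.span T" for X
  proof -
    have "\<phi> X = (\<Sum>p\<in>{..<n} \<times> {..<n}. scale (X $$ p) (\<lambda>x. if x = p then 1 else 0))"
      by (rule ext) (auto simp: sum_apply scale_def \<phi>_def if_distrib[of "(*) c" for c] cong: if_cong split: if_splits)
    also have "\<dots> \<in> V.span T"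
      by (intro V.span_sum V.span_scale V.span_base) (auto simp: T_def)
    finally show ?thesis .
  qed
  then have "B \<subseteq> V.span T"
    using B(1) by auto
  moreover have "finite T"
    by (simp add: T_def)
  ultimately have finB: "finite B"
    using V.independent_span_bound[OF _ B(2)] by blast
  obtain h where h: "bij_betw h {..<card B} B"
    using ex_bij_betw_nat_finite[OF finB] by (auto simp: atLeast0LessThan)
  have "\<forall>s<card B. \<exists>X\<in>S. h s = \<phi> X"
    using h B(1) by (fastforce simp: bij_betw_def)
  then obtain e where e: "\<And>s. s < card B \<Longrightarrow> e s \<in> S \<and> h s = \<phi> (e s)"
    by metis
  have reindex: "(\<Sum>v\<in>B. scale (u v) v) = (\<Sum>s<card B. scale (u (h s)) (\<phi> (e s)))" for u
    using sum.reindex_bij_betw[OF h, of "\<lambda>v. scale (u v) v"] e by simp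
  show thesis
  proof
    show "e s \<in> S" if "s < card B" for s
      using e that by simp
  next
    fix X assume X: "X \<in> S"
    obtain u where u: "\<phi> X = (\<Sum>v\<in>B. scale (u v) v)"
      using B(3) X V.span_finite[OF finB] by blast
    have "X = lincomb_mat n (card B) e (\<lambda>s. u (h s))"
    proof (rule eq_matI)
      fix i j
      assume "i < dim_row (lincomb_mat n (card B) e (\<lambda>s. u (h s)))"
        "j < dim_col (lincomb_mat n (card B) e (\<lambda>s. u (h s)))"
      then show "X $$ (i, j) = lincomb_mat n (card B) e (\<lambda>s. u (h s)) $$ (i, j)"
        using fun_cong[OF u[unfolded reindex], of "(i, j)"]
        by (simp add: lincomb_mat_def sum_apply scale_def \<phi>_def)
    qed (use X S in \<open>auto simp: lincomb_mat_def\<close>)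
    then show "\<exists>c. X = lincomb_mat n (card B) e c" by blast
  next
    fix c s
    assume c: "lincomb_mat n (card B) e c = 0\<^sub>m n n" and s: "s < card B"
    \<comment> \<open>Independence in \<open>V\<close> concerns coefficients indexed by the vectors
      themselves, so \<open>c\<close> is pulled back along the enumeration \<open>h\<close>.\<close>
    define u where "u v = c (the_inv_into {..<card B} h v)" for v
    have uh: "u (h s) = c s" if "s < card B" for s
      using h that by (auto simp: u_def bij_betw_def the_inv_into_f_f)
    have "(\<Sum>v\<in>B. scale (u v) v) = (\<Sum>s<card B. scale (c s) (\<phi> (e s)))"
      unfolding reindex by (simp add: uh)
    also have "\<dots> = 0"
    proof
      fix x :: "nat \<times> nat"
      obtain i j where x: "x = (i, j)"
        by (cases x)
      show "(\<Sum>s<card B. scale (c s) (\<phi> (e s))) x = 0 x"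
        using arg_cong[OF c, of "\<lambda>M. M $$ (i, j)"]
        by (cases "i < n \<and> j < n") (auto simp: x sum_apply scale_def \<phi>_def lincomb_mat_def)
    qed
    finally have "\<forall>v\<in>B. u v = 0"
      using B(2) V.dependent_finite[OF finB] by blast
    then show "c s = 0"
      using uh[OF s] bij_betwE[OF h] s by (metis lessThan_iff)
  qed
qed

lemma lincomb_mat_carrier [simp]: "lincomb_mat n r e c \<in> carrier_mat n n"
  by (simp add: lincomb_mat_def)

lemma lincomb_mat_cong:
  "(\<And>s. s < r \<Longrightarrow> e s = f s) \<Longrightarrow> (\<And>s. s < r \<Longrightarrow> b s = c s) \<Longrightarrow> lincomb_mat n r e b = lincomb_mat n r f c"
  by (auto simp: lincomb_mat_def intro!: eq_matI)

lemma lincomb_mat_add: "lincomb_mat n r e b + lincomb_mat n r e c = lincomb_mat n r e (\<lambda>s. b s + c s)"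
  by (auto simp: lincomb_mat_def sum.distrib algebra_simps intro!: eq_matI)

lemma lincomb_mat_diff: "lincomb_mat n r e b - lincomb_mat n r e c = lincomb_mat n r e (\<lambda>s. b s - c s)"
  by (auto simp: lincomb_mat_def sum_subtractf algebra_simps intro!: eq_matI)

lemma lincomb_mat_uminus: "lincomb_mat n r e (\<lambda>s. - c s) = - lincomb_mat n r e c"
  by (auto simp: lincomb_mat_def sum_negf intro!: eq_matI)

lemma lincomb_mat_0: "lincomb_mat n r e (\<lambda>s. 0) = 0\<^sub>m n n"
  by (auto simp: lincomb_mat_def intro!: eq_matI)

lemma lincomb_mat_lincomb_mat:
  "lincomb_mat n m (\<lambda>s. lincomb_mat n r e (g s)) c = lincomb_mat n r e (\<lambda>t. \<Sum>s<m. c s * g s t)"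
  by (auto simp: lincomb_mat_def sum_distrib_left sum_distrib_right mult.assoc intro!: eq_matI sum.swap)

lemma lincomb_mat_mult:
  assumes "A \<in> carrier_mat n n" "\<And>s. s < r \<Longrightarrow> e s \<in> carrier_mat n n"
  shows "A * lincomb_mat n r e c = lincomb_mat n r (\<lambda>s. A * e s) c"
    and "lincomb_mat n r e c * A = lincomb_mat n r (\<lambda>s. e s * A) c"
proof -
  have dims: "dim_row (e s) = n" "dim_col (e s) = n" if "s < r" for s
    using assms(2)[OF that] by auto
  have "(A * lincomb_mat n r e c) $$ (i, j) = lincomb_mat n r (\<lambda>s. A * e s) c $$ (i, j)"
    if ij: "i < n" "j < n" for i j
  proof -
    have "(A * lincomb_mat n r e c) $$ (i, j) = (\<Sum>k<n. \<Sum>s<r. c s * (A $$ (i, k) * e s $$ (k, j)))"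
      using assms(1) ij by (simp add: lincomb_mat_def scalar_prod_def sum_distrib_left mult_ac atLeast0LessThan)
    also have "\<dots> = (\<Sum>s<r. \<Sum>k<n. c s * (A $$ (i, k) * e s $$ (k, j)))"
      by (rule sum.swap)
    also have "\<dots> = (\<Sum>s<r. c s * (A * e s) $$ (i, j))"
      using assms(1) ij by (intro sum.cong) (auto simp: dims scalar_prod_def sum_distrib_left atLeast0LessThan)
    finally show ?thesis
      using ij by (simp add: lincomb_mat_def del: index_mult_mat(1))
  qed
  then show "A * lincomb_mat n r e c = lincomb_mat n r (\<lambda>s. A * e s) c"
    using assms(1) by (intro eq_matI) (auto simp: lincomb_mat_def simp del: index_mult_mat(1))
  have "(lincomb_mat n r e c * A) $$ (i, j) = lincomb_mat n r (\<lambda>s. e s * A) c $$ (i, j)"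
    if ij: "i < n" "j < n" for i j
  proof -
    have "(lincomb_mat n r e c * A) $$ (i, j) = (\<Sum>k<n. \<Sum>s<r. c s * (e s $$ (i, k) * A $$ (k, j)))"
      using assms(1) ij by (simp add: lincomb_mat_def scalar_prod_def sum_distrib_left mult_ac atLeast0LessThan)
    also have "\<dots> = (\<Sum>s<r. \<Sum>k<n. c s * (e s $$ (i, k) * A $$ (k, j)))"
      by (rule sum.swap)
    also have "\<dots> = (\<Sum>s<r. c s * (e s * A) $$ (i, j))"
      using assms(1) ij by (intro sum.cong) (auto simp: dims scalar_prod_def sum_distrib_left atLeast0LessThan)
    finally show ?thesis
      using ij by (simp add: lincomb_mat_def del: index_mult_mat(1))
  qed
  then show "lincomb_mat n r e c * A = lincomb_mat n r (\<lambda>s. e s * A) c"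
    using assms(1) by (intro eq_matI) (auto simp: lincomb_mat_def simp del: index_mult_mat(1))
qed

text \<open>The Leibniz rule, with scalars passing through the commutator. The array
  \<open>g\<close> is the connection matrix in the frame \<open>e\<close>: \<open>g s t\<close> is
  the coefficient of \<open>e t\<close> in the derivative of \<open>e s\<close>.\<close>

lemma cov_lincomb_mat:
  assumes D: "derivation D" and A: "A \<in> carrier_mat n n"
    and e: "\<And>s. s < r \<Longrightarrow> e s \<in> carrier_mat n n"
    and g: "\<And>s. s < r \<Longrightarrow> cov D A (e s) = lincomb_mat n r e (g s)"
  shows "cov D A (lincomb_mat n r e c) = lincomb_mat n r e (\<lambda>t. D (c t) + (\<Sum>s<r. c s * g s t))"
proof -
  have mult: "A * lincomb_mat n r e c = lincomb_mat n r (\<lambda>s. A * e s) c"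
    "lincomb_mat n r e c * A = lincomb_mat n r (\<lambda>s. e s * A) c"
    using lincomb_mat_mult A e by blast+
  have "cov D A (lincomb_mat n r e c) = lincomb_mat n r e (\<lambda>t. D (c t)) + lincomb_mat n r (\<lambda>s. cov D A (e s)) c"
  proof (rule eq_matI)
    fix i j
    assume "i < dim_row (lincomb_mat n r e (\<lambda>t. D (c t)) + lincomb_mat n r (\<lambda>s. cov D A (e s)) c)"
      "j < dim_col (lincomb_mat n r e (\<lambda>t. D (c t)) + lincomb_mat n r (\<lambda>s. cov D A (e s)) c)"
    then have ij: "i < n" "j < n"
      by (auto simp: lincomb_mat_def)
    have dims: "dim_row (e s) = n" "dim_col (e s) = n" if "s < r" for s
      using e[OF that] by auto
    show "cov D A (lincomb_mat n r e c) $$ (i, j) =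
       (lincomb_mat n r e (\<lambda>t. D (c t)) + lincomb_mat n r (\<lambda>s. cov D A (e s)) c) $$ (i, j)"
      using ij A unfolding cov_def mat_commutator_def mult
      by (simp add: lincomb_mat_def dims derivation_simps(2)[OF D] derivation_sum[OF D] sum.distrib[symmetric]
          sum_subtractf[symmetric] algebra_simps del: index_mult_mat(1))
  qed (use A in \<open>auto simp: lincomb_mat_def cov_def mat_commutator_def\<close>)
  also have "lincomb_mat n r (\<lambda>s. cov D A (e s)) c = lincomb_mat n r (\<lambda>s. lincomb_mat n r e (g s)) c"
    by (intro lincomb_mat_cong) (simp_all add: g)
  finally show ?thesis
    by (simp add: lincomb_mat_lincomb_mat lincomb_mat_add)
qed

lemma cov_0:
  assumes "derivation D" "A \<in> carrier_mat n n"
  shows "cov D A (0\<^sub>m n n) = 0\<^sub>m n n"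
  using assms
  by (auto simp: cov_def mat_commutator_def derivation_simps[OF assms(1)] intro!: eq_matI)

lemma cov_uminus:
  assumes "derivation D" "A \<in> carrier_mat n n" "X \<in> carrier_mat n n"
  shows "cov D A (- X) = - cov D A X"
  using assms
  by (auto simp: cov_def mat_commutator_def derivation_simps[OF assms(1)] intro!: eq_matI)

section \<open>Solving inhomogeneous systems over the constants\<close>

lemma fundamental_solution_last_row:
  assumes Y: "fundamental_solution_matrix D i (Suc r) C Y"
  obtains q where "q < Suc r" "Y $$ (r, q) \<noteq> 0"
proof -
  have Yc: "Y \<in> carrier_mat (Suc r) (Suc r)"
    using Y by (simp add: fundamental_solution_matrix_def)
  obtain Z where Z: "Y * Z = 1\<^sub>m (Suc r)" "Z * Y = 1\<^sub>m (dim_row Z)"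
    using Y Yc by (auto simp: fundamental_solution_matrix_def invertible_mat_def inverts_mat_def)
  have Zc: "dim_col Z = Suc r" "dim_row Z = Suc r"
    using arg_cong[OF Z(1), of dim_col] arg_cong[OF Z(2), of dim_col] Yc by auto
  \<comment> \<open>This diagonal entry is 1, so row \<open>r\<close> of \<open>Y\<close> cannot
    vanish.\<close>
  have "(\<Sum>q<Suc r. Y $$ (r, q) * Z $$ (q, r)) = (Y * Z) $$ (r, r)"
    using Yc Zc by (simp add: scalar_prod_def atLeast0LessThan)
  also have "\<dots> \<noteq> 0"
    by (simp add: Z)
  finally have "\<exists>q<Suc r. Y $$ (r, q) \<noteq> 0"
    by (metis (no_types, lifting) lessThan_iff mult_zero_left sum.neutral)
  then show thesis
    using that by blast
qed

text \<open>By \<open>flat0\<close> every \<open>cov (Ds j) (P j)\<close> preserves the kernel of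
  \<open>cov D A\<close>, and by \<open>F0\<close> the right-hand sides lie in it. There
  \<open>flat\<close> and \<open>FF\<close> are exactly the integrability conditions, so after
  passing to coordinates \<open>sol\<close> applies.\<close>

lemma inhomogeneous_solution:
  fixes D :: "'a::field \<Rightarrow> 'a" and Ds :: "nat \<Rightarrow> 'a \<Rightarrow> 'a" and P F :: "nat \<Rightarrow> 'a mat"
  assumes D: "derivation D" and Ds: "\<And>j. j \<in> {1..i} \<Longrightarrow> derivation (Ds j)"
    and DDs: "\<And>j. j \<in> {1..i} \<Longrightarrow> commuting_maps D (Ds j)"
    and DsDs: "\<And>a b. a \<in> {1..i} \<Longrightarrow> b \<in> {1..i} \<Longrightarrow> commuting_maps (Ds a) (Ds b)"
    and sol: "\<And>m C. linear_system (constants D) i m C \<Longrightarrow> consistent_system Ds i C \<Longrightarrow>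
        \<exists>Y. mat_over (constants D) m Y \<and> fundamental_solution_matrix Ds i m C Y"
    and A: "A \<in> carrier_mat n n" and P: "\<And>j. j \<in> {1..i} \<Longrightarrow> P j \<in> carrier_mat n n"
    and F: "\<And>j. j \<in> {1..i} \<Longrightarrow> F j \<in> carrier_mat n n"
    and flat0: "\<And>j. j \<in> {1..i} \<Longrightarrow> curv D A (Ds j) (P j) = 0\<^sub>m n n"
    and flat: "\<And>a b. a \<in> {1..i} \<Longrightarrow> b \<in> {1..i} \<Longrightarrow> curv (Ds a) (P a) (Ds b) (P b) = 0\<^sub>m n n"
    and F0: "\<And>j. j \<in> {1..i} \<Longrightarrow> cov D A (F j) = 0\<^sub>m n n"
    and FF: "\<And>a b. a \<in> {1..i} \<Longrightarrow> b \<in> {1..i} \<Longrightarrow> cov (Ds a) (P a) (F b) = cov (Ds b) (P b) (F a)"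
  obtains X where "X \<in> carrier_mat n n" "cov D A X = 0\<^sub>m n n"
    and "\<And>j. j \<in> {1..i} \<Longrightarrow> cov (Ds j) (P j) X = F j"
proof -
  define S where "S = {X \<in> carrier_mat n n. cov D A X = 0\<^sub>m n n}"
  have "S \<subseteq> carrier_mat n n"
    by (auto simp: S_def)
  then obtain r e where eS: "\<And>s. s < r \<Longrightarrow> e s \<in> S"
    and span: "\<And>X. X \<in> S \<Longrightarrow> \<exists>c. X = lincomb_mat n r e c"
    and indep: "\<And>c s. lincomb_mat n r e c = 0\<^sub>m n n \<Longrightarrow> s < r \<Longrightarrow> c s = 0"
    using maximal_independent_family by blast
  have e: "e s \<in> carrier_mat n n" "cov D A (e s) = 0\<^sub>m n n" if "s < r" for s
    using eS[OF that] by (auto simp: S_def)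
  have inj: "b s = c s" if "lincomb_mat n r e b = lincomb_mat n r e c" "s < r" for b c s
  proof -
    have "lincomb_mat n r e (\<lambda>s. b s - c s) = lincomb_mat n r e c - lincomb_mat n r e c"
      by (simp only: that(1) lincomb_mat_diff[symmetric])
    also have "\<dots> = 0\<^sub>m n n"
      by (rule minus_r_inv_mat) simp
    finally show ?thesis
      using indep[of "\<lambda>s. b s - c s" s] that(2) by simp
  qed
  \<comment> \<open>The basis is annihilated by \<open>cov D A\<close>, so its connection matrix is
    0 and only the coefficients are differentiated.\<close>
  have covD: "cov D A (lincomb_mat n r e c) = lincomb_mat n r e (\<lambda>t. D (c t))" for c
    using cov_lincomb_mat[where D = D and A = A and e = e and n = n and r = r and c = c and g = "\<lambda>_ _. 0"] D A e
    by (simp add: lincomb_mat_0)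
  txt \<open>The index \<open>r\<close> stands for a formal basis vector whose derivatives are \<open>- F j\<close>; this way commutation
    of the connections and the compatibility of \<open>F\<close> are a single identity \<open>G_swap\<close>.\<close>
  define G where "G j s = (if s < r then cov (Ds j) (P j) (e s) else - F j)" for j s
  have G_S: "G j s \<in> S" if j: "j \<in> {1..i}" for j s
  proof (cases "s < r")
    case True
    have "cov D A (cov (Ds j) (P j) (e s)) = cov (Ds j) (P j) (0\<^sub>m n n)"
      using cov_commute[OF D Ds DDs A P e(1) flat0] j True by (simp add: e)
    also have "\<dots> = 0\<^sub>m n n"
      using Ds[OF j] P[OF j] by (rule cov_0)
    finally show ?thesis
      using P[OF j] True e by (simp add: S_def G_def)
  qed (use j in \<open>auto simp: S_def G_def F F0 cov_uminus[OF D A] intro!: eq_matI\<close>)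
  have "\<forall>j\<in>{1..i}. \<forall>s. \<exists>c. G j s = lincomb_mat n r e c"
    using span G_S by blast
  then obtain g where g: "\<And>j s. j \<in> {1..i} \<Longrightarrow> G j s = lincomb_mat n r e (g j s)"
    by metis
  \<comment> \<open>Since \<open>G j s\<close> lies in the kernel, \<open>covD\<close> yields a
    vanishing combination with coefficients \<open>D (g j s t)\<close>; independence
    applies.\<close>
  have g_const: "D (g j s t) = 0" if "j \<in> {1..i}" "t < r" for j s t
    using G_S[of j s] indep[of "\<lambda>t. D (g j s t)" t] that by (simp add: S_def g covD)
  have cov_comb: "cov (Ds j) (P j) (lincomb_mat n r e c) =
      lincomb_mat n r e (\<lambda>t. Ds j (c t) + (\<Sum>s<r. c s * g j s t))" if j: "j \<in> {1..i}" for j c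
    by (intro cov_lincomb_mat[OF Ds[OF j] P[OF j] e(1)]) (simp_all add: g[OF j, symmetric] G_def)
  have G_swap: "cov (Ds a) (P a) (G b s) = cov (Ds b) (P b) (G a s)" if "a \<in> {1..i}" "b \<in> {1..i}" for a b s
    using that FF[of a b] cov_commute[OF Ds Ds DsDs P P e(1) flat, of a b s]
    by (simp add: G_def cov_uminus[OF Ds P F])
  txt \<open>The last column carries the inhomogeneous term; the last row is zero, so the last row of a
    fundamental solution consists of constants of all \<open>Ds j\<close>, and one of them can be scaled to 1.\<close>
  define C where "C j = mat (Suc r) (Suc r) (\<lambda>(t, s). if t < r then - g j s t else 0)" for j
  have "linear_system (constants D) i (Suc r) C"
    using g_const
    by (auto simp: linear_system_def mat_over_def constants_def C_def derivation_simps[OF D] dest!: elements_matD)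
  moreover have "consistent_system Ds i C"
    unfolding consistent_system_def
  proof (intro ballI)
    fix a b assume ab: "a \<in> {1..i}" "b \<in> {1..i}"
    \<comment> \<open>Comparing coordinates in \<open>G_swap\<close> gives consistency of
      \<open>C\<close>; the value \<open>s = r\<close> covers the inhomogeneous column.\<close>
    have key: "Ds a (g b s t) + (\<Sum>u<r. g b s u * g a u t) = Ds b (g a s t) + (\<Sum>u<r. g a s u * g b u t)"
      if "t < r" for s t
    proof -
      have "lincomb_mat n r e (\<lambda>t. Ds a (g b s t) + (\<Sum>u<r. g b s u * g a u t)) =
          lincomb_mat n r e (\<lambda>t. Ds b (g a s t) + (\<Sum>u<r. g a s u * g b u t))"
        using G_swap[OF ab, of s] ab by (simp add: g cov_comb)
      from inj[OF this that] show ?thesis .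
    qed
    show "map_mat (Ds a) (C b) - map_mat (Ds b) (C a) = mat_commutator (C a) (C b)"
    proof (rule eq_matI)
      fix t s assume "t < dim_row (mat_commutator (C a) (C b))" "s < dim_col (mat_commutator (C a) (C b))"
      then have ts: "t < Suc r" "s < Suc r"
        by (auto simp: mat_commutator_def C_def)
      \<comment> \<open>The summand \<open>u = r\<close> drops because the last row of
        \<open>C b\<close> is zero, and the two minus signs cancel.\<close>
      have "(C a * C b) $$ (t, s) = (if t < r then \<Sum>u<r. g b s u * g a u t else 0)" for a b
        using ts by (auto simp: C_def scalar_prod_def atLeast0LessThan mult.commute)
      then show "(map_mat (Ds a) (C b) - map_mat (Ds b) (C a)) $$ (t, s) = mat_commutator (C a) (C b) $$ (t, s)"
        using ts key[of t s]
        by (auto simp: mat_commutator_def C_def derivation_simps[OF Ds[OF ab(1)]] derivation_simps[OF Ds[OF ab(2)]]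
            algebra_simps simp del: index_mult_mat(1))
    qed (auto simp: mat_commutator_def C_def)
  qed
  ultimately obtain Y where Yk: "mat_over (constants D) (Suc r) Y"
    and Y: "fundamental_solution_matrix Ds i (Suc r) C Y"
    using sol by blast
  have Yc: "Y \<in> carrier_mat (Suc r) (Suc r)"
    using Y by (simp add: fundamental_solution_matrix_def)
  obtain q where q: "q < Suc r" "Y $$ (r, q) \<noteq> 0"
    using fundamental_solution_last_row[OF Y] .
  have Y_const: "D (Y $$ (t, q)) = 0" if "t < Suc r" for t
    using Yk that q elements_matI[OF Yc that q(1) refl] by (auto simp: mat_over_def constants_def)
  have Y_eq: "Ds j (Y $$ (t, q)) = (\<Sum>u<Suc r. C j $$ (t, u) * Y $$ (u, q))"
    if "j \<in> {1..i}" "t < Suc r" for j t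
  proof -
    have "map_mat (Ds j) Y = C j * Y"
      using Y that by (simp add: fundamental_solution_matrix_def)
    from arg_cong[OF this, of "\<lambda>M. M $$ (t, q)"] show ?thesis
      using that q Yc by (simp add: scalar_prod_def C_def atLeast0LessThan)
  qed
  define x where "x t = Y $$ (t, q) / Y $$ (r, q)" for t
  have x_const: "D (x t) = 0" if "t < r" for t
    using that Y_const by (simp add: x_def derivation_divide_constant[OF D])
  have x_eq: "Ds j (x t) + (\<Sum>s<r. x s * g j s t) = - g j r t" if j: "j \<in> {1..i}" and t: "t < r" for j t
  proof -
    \<comment> \<open>Hence dividing column \<open>q\<close> by its last entry preserves the
      equations; the last unknown becomes 1 and contributes \<open>- g j r t\<close>.\<close>
    have "Ds j (Y $$ (r, q)) = 0"
      unfolding Y_eq[OF j lessI] by (intro sum.neutral) (simp add: C_def)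
    then have "Ds j (x t) = Ds j (Y $$ (t, q)) / Y $$ (r, q)"
      unfolding x_def by (rule derivation_divide_constant[OF Ds[OF j]])
    also have "\<dots> = - (\<Sum>s<r. x s * g j s t) - g j r t"
      using t q Y_eq[OF j less_SucI[OF t]]
      by (simp add: C_def x_def sum_negf diff_divide_distrib sum_divide_distrib mult.commute)
    finally show ?thesis
      by simp
  qed
  show thesis
  proof
    show "lincomb_mat n r e x \<in> carrier_mat n n"
      by simp
    show "cov D A (lincomb_mat n r e x) = 0\<^sub>m n n"
      unfolding covD lincomb_mat_0[symmetric, of n r e] by (intro lincomb_mat_cong) (simp_all add: x_const)
    fix j assume j: "j \<in> {1..i}"
    have "cov (Ds j) (P j) (lincomb_mat n r e x) = lincomb_mat n r e (\<lambda>t. - g j r t)"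
      unfolding cov_comb[OF j] by (intro lincomb_mat_cong) (simp_all add: x_eq[OF j])
    \<comment> \<open>At the formal index, \<open>G j r\<close> is \<open>- F j\<close>, so the
      signs cancel.\<close>
    also have "\<dots> = - G j r"
      by (simp add: lincomb_mat_uminus g[OF j])
    also have "\<dots> = F j"
      using F[OF j] by (simp add: G_def)
    finally show "cov (Ds j) (P j) (lincomb_mat n r e x) = F j" .
  qed
qed

section \<open>Inductive construction of the flat family\<close>

theorem theorem6p4:
  fixes D :: "'a::field_char_0 \<Rightarrow> 'a"
    and Ds :: "nat \<Rightarrow> 'a \<Rightarrow> 'a"
    and d n :: nat
    and A :: "'a mat"
    and k :: "'a set"
  assumes "derivation D"
    and "\<forall>i\<in>{1..d}. derivation (Ds i)"
    and "\<forall>i\<in>{1..d}. commuting_maps D (Ds i)"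
    and "\<forall>i\<in>{1..d}. \<forall>j\<in>{1..d}. commuting_maps (Ds i) (Ds j)"
    and "k = constants D"
    and "\<forall>i\<in>{1..d-1}. \<forall>m C. linear_system k i m C \<longrightarrow> consistent_system Ds i C \<longrightarrow>
           (\<exists>Y. mat_over k m Y \<and> fundamental_solution_matrix Ds i m C Y)"
    and "A \<in> carrier_mat n n"
    and "\<exists>B. \<forall>i\<in>{1..d}. B i \<in> carrier_mat n n \<and>
           map_mat (Ds i) A - map_mat D (B i) = mat_commutator (B i) A"
  shows "\<exists>A'. (\<forall>i\<in>{1..d}. A' i \<in> carrier_mat n n) \<and>
           (\<forall>i\<in>{1..d}. map_mat (Ds i) A - map_mat D (A' i) = mat_commutator (A' i) A) \<and>
           (\<forall>i\<in>{1..d}. \<forall>j\<in>{1..d}.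
              map_mat (Ds i) (A' j) - map_mat (Ds j) (A' i) = mat_commutator (A' i) (A' j))"
proof -
  note A = \<open>A \<in> carrier_mat n n\<close>
  obtain B where B: "\<And>j. j \<in> {1..d} \<Longrightarrow> B j \<in> carrier_mat n n"
    and B0: "\<And>j. j \<in> {1..d} \<Longrightarrow> curv D A (Ds j) (B j) = 0\<^sub>m n n"
    using assms(8) curv_eq_0_iff[OF _ A] curv_swap_eq_0[OF A] by metis
  \<comment> \<open>Invariant: the first \<open>i\<close> connections are flat against that of
    \<open>A\<close> and against one another.\<close>
  have "\<exists>P. (\<forall>j\<in>{1..i}. P j \<in> carrier_mat n n \<and> curv D A (Ds j) (P j) = 0\<^sub>m n n) \<and>
      (\<forall>a\<in>{1..i}. \<forall>b\<in>{1..i}. curv (Ds a) (P a) (Ds b) (P b) = 0\<^sub>m n n)" if "i \<le> d" for i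
    using that
  proof (induction i)
    case (Suc i)
    from Suc.IH[OF Suc_leD[OF Suc.prems]] obtain P where P: "\<And>j. j \<in> {1..i} \<Longrightarrow> P j \<in> carrier_mat n n"
      and P0: "\<And>j. j \<in> {1..i} \<Longrightarrow> curv D A (Ds j) (P j) = 0\<^sub>m n n"
      and PP: "\<And>a b. a \<in> {1..i} \<Longrightarrow> b \<in> {1..i} \<Longrightarrow> curv (Ds a) (P a) (Ds b) (P b) = 0\<^sub>m n n"
      by blast
    let ?E = "Ds (Suc i)" and ?B = "B (Suc i)"
    have Si: "Suc i \<in> {1..d}" and sub: "\<And>j. j \<in> {1..i} \<Longrightarrow> j \<in> {1..d}"
      using Suc.prems by auto
    define F where "F j = curv (Ds j) (P j) ?E ?B" for j
    have cov0: "cov (Ds j) (P j) (0\<^sub>m n n) = 0\<^sub>m n n" if "j \<in> {1..i}" for j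
      using P[OF that] assms(2) sub[OF that] by (intro cov_0) auto
    obtain X where X: "X \<in> carrier_mat n n" "cov D A X = 0\<^sub>m n n"
      and XF: "\<And>j. j \<in> {1..i} \<Longrightarrow> cov (Ds j) (P j) X = F j"
    proof (cases "i = 0")
      \<comment> \<open>No equation indexed by \<open>j\<close> is present, and the solvability
        hypothesis starts only at one derivation; \<open>X = 0\<close> suffices.\<close>
      case True
      show thesis
        by (rule that[of "0\<^sub>m n n"])
          (use True A assms(1) in \<open>auto simp: cov_0\<close>)
    next
      case False
      \<comment> \<open>Constructing matrix \<open>Suc i\<close> calls for systems in the first
        \<open>i\<close> derivations only, hence the bound \<open>d - 1\<close>.\<close>
      with Suc.prems have "i \<in> {1..d - 1}"
        by auto
      then have sol: "\<exists>Y. mat_over (constants D) m Y \<and> fundamental_solution_matrix Ds i m C Y"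
        if "linear_system (constants D) i m C" "consistent_system Ds i C" for m C
        using assms(5,6) that by blast
      show thesis
      proof (rule inhomogeneous_solution[of D i Ds A n P F])
        fix j assume j: "j \<in> {1..i}"
        show "F j \<in> carrier_mat n n"
          using P[OF j] B[OF Si] by (simp add: F_def)
        \<comment> \<open>Bianchi for \<open>A\<close>, \<open>P j\<close> and \<open>?B\<close>;
          the inner curvature vanishes by the choice of \<open>B\<close>.\<close>
        have "cov D A (F j) = cov (Ds j) (P j) (curv D A ?E ?B)"
          unfolding F_def using assms(1-4) sub[OF j] Si A P[OF j] B[OF Si] P0[OF j] by (intro bianchi) auto
        then show "cov D A (F j) = 0\<^sub>m n n"
          by (simp add: B0[OF Si] cov0[OF j])
      next
        fix a b assume "a \<in> {1..i}" "b \<in> {1..i}"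
        then show "cov (Ds a) (P a) (F b) = cov (Ds b) (P b) (F a)"
          unfolding F_def using assms(1-4) sub Si P B[OF Si] PP by (intro bianchi) auto
      qed (use assms(1-4) sub sol A P P0 PP that in auto)
    qed
    \<comment> \<open>By \<open>curv_add_right\<close>, adding \<open>X\<close> leaves the curvature
      against \<open>A\<close> at 0, as \<open>cov D A X\<close> vanishes, and changes that against
      \<open>P j\<close> from \<open>F j\<close> to \<open>F j - F j\<close>.\<close>
    define Q where "Q = P(Suc i := ?B + X)"
    have Q_old: "Q j = P j" if "j \<in> {1..i}" for j
      using that by (auto simp: Q_def)
    have Q_new: "Q (Suc i) \<in> carrier_mat n n" "curv D A ?E (Q (Suc i)) = 0\<^sub>m n n"
      using X B[OF Si] B0[OF Si] A assms(1) by (auto simp: Q_def curv_add_right)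
    have Q_flat: "curv (Ds j) (Q j) ?E (Q (Suc i)) = 0\<^sub>m n n" if j: "j \<in> {1..i}" for j
    proof -
      have "curv (Ds j) (P j) ?E (?B + X) = F j - F j"
        using assms(2) sub[OF j] curv_add_right[of "Ds j" "P j" n ?B X ?E] P[OF j] B[OF Si] X(1) XF[OF j] by (simp add: F_def)
      also have "\<dots> = 0\<^sub>m n n"
        using P[OF j] B[OF Si] by (intro minus_r_inv_mat) (simp add: F_def)
      finally show ?thesis
        using j by (simp add: Q_def)
    qed
    have range: "{1..Suc i} = insert (Suc i) {1..i}"
      by auto
    have "Q j \<in> carrier_mat n n" if "j \<in> {1..i}" for j
      using P that by (simp add: Q_old)
    then have "curv ?E (Q (Suc i)) (Ds j) (Q j) = 0\<^sub>m n n" if "j \<in> {1..i}" for j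
      using Q_flat that Q_new curv_swap_eq_0 by blast
    \<comment> \<open>Old pairs are covered by \<open>PP\<close>, mixed pairs by
      \<open>Q_flat\<close> and its swapped form, the new diagonal pair by
      \<open>curv_self\<close>.\<close>
    then show ?case
      unfolding range using P P0 PP Q_old Q_new Q_flat curv_self[OF Q_new(1)]
      by (intro exI[of _ Q]) auto
  qed simp
  from this[OF order_refl] obtain P where P: "\<And>j. j \<in> {1..d} \<Longrightarrow> P j \<in> carrier_mat n n"
    and P0: "\<And>j. j \<in> {1..d} \<Longrightarrow> curv D A (Ds j) (P j) = 0\<^sub>m n n"
    and PP: "\<And>a b. a \<in> {1..d} \<Longrightarrow> b \<in> {1..d} \<Longrightarrow> curv (Ds a) (P a) (Ds b) (P b) = 0\<^sub>m n n"
    by blast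
  show ?thesis
  proof (intro exI[of _ P] conjI ballI)
    fix a assume a: "a \<in> {1..d}"
    show "P a \<in> carrier_mat n n"
      by (rule P[OF a])
    show "map_mat (Ds a) A - map_mat D (P a) = mat_commutator (P a) A"
      using P0[OF a] P[OF a] A curv_swap_eq_0 curv_eq_0_iff by blast
  next
    fix a b assume ab: "a \<in> {1..d}" "b \<in> {1..d}"
    show "map_mat (Ds a) (P b) - map_mat (Ds b) (P a) = mat_commutator (P a) (P b)"
      using PP[OF ab] P ab curv_eq_0_iff by blast
  qed
qed

end
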